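(* There exist a compact complex manifold $T$ equipped with a hermitian metric $h$, and open subsets $\Omega_2\subset\Omega_1\subset T$, such that: (1) $\Omega_2$ is not dense in $\Omega_1$, and $\Omega_1$ is not dense in $T$. (2) For every point $p\in\Omega_1$ there is a non-constant holomorphic map $f:\mathbb{C}\to\Omega_1$ with $f(0)=p$. (3) If $f:\mathbb{C}\to T$ is a non-constant holomorphic map with bounded derivative (with respect to the euclidean metric on $\mathbb{C}$ and $h$ on $T$) and $f(\mathbb{C})\subset\overline{\Omega_1}$, then $f(\mathbb{C})\subset\overline{\Omega_2}$.
   Context: A holomorphic map $f:\mathbb{C}\to T$ to a complex manifold with hermitian metric $h$ has bounded derivative if there is a constant $C>0$ such that $\|Df_z\|<C$ for all $z\in\mathbb{C}$, where the norm of $Df_z:T_z\mathbb{C}\to T_{f(z)}T$ is taken with respect to the euclidean metric on $\mathbb{C}$ and $h$ on $T$. Closures $\overline{\Omega_i}$ are taken in $T$ with respect to the usual (manifold) topology. *)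

theory Defs
  imports "HOL-Analysis.Analysis"
begin

text \<open>
  The dimension of a manifold is a natural number bound inside the statement, so the model space
  \<open>\<complex>\<^sup>n\<close> is the set of sequences vanishing from index \<open>n\<close> on. The product topology of
  \<^typ>\<open>nat \<Rightarrow> complex\<close> induces the usual topology on it.
\<close>

type_synonym cvec = "nat \<Rightarrow> complex"

definition cspace :: "nat \<Rightarrow> cvec set"
  where "cspace n = {x. \<forall>i\<ge>n. x i = 0}"

definition cnorm :: "nat \<Rightarrow> cvec \<Rightarrow> real"
  where "cnorm n x = sqrt (\<Sum>i<n. (cmod (x i))\<^sup>2)"

text \<open>Complex (Frechet) differentiability at every point, for functions on open subsets of \<open>\<complex>\<^sup>n\<close>.\<close>

definition cn_holomorphic_on :: "nat \<Rightarrow> cvec set \<Rightarrow> (cvec \<Rightarrow> complex) \<Rightarrow> bool"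
  where "cn_holomorphic_on n U f \<longleftrightarrow>
    (\<forall>x\<in>U. \<exists>a :: cvec.
      ((\<lambda>y. (f y - f x - (\<Sum>i<n. a i * (y i - x i))) / of_real (cnorm n (\<lambda>i. y i - x i)))
        \<longlongrightarrow> 0) (at x within U))"

definition cpartial :: "nat \<Rightarrow> (cvec \<Rightarrow> complex) \<Rightarrow> cvec \<Rightarrow> complex"
  where "cpartial j f x = deriv (\<lambda>w. f (x(j := w))) (x j)"

text \<open>
  \<open>C\<^sup>k\<close> in the real sense: the coordinate directions of \<open>\<complex>\<^sup>n = \<real>\<^sup>2\<^sup>n\<close> are \<open>e\<^sub>j\<close> and \<open>\<i> e\<^sub>j\<close> for \<open>j < n\<close>.
\<close>

primrec Ck_on :: "nat \<Rightarrow> nat \<Rightarrow> cvec set \<Rightarrow> (cvec \<Rightarrow> complex) \<Rightarrow> bool"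
  where
    "Ck_on n 0 U f \<longleftrightarrow> continuous_on U f"
  | "Ck_on n (Suc k) U f \<longleftrightarrow> continuous_on U f \<and>
      (\<forall>j<n. \<forall>v\<in>{1, \<i>}. \<exists>g. Ck_on n k U g \<and>
        (\<forall>x\<in>U. ((\<lambda>t. f (x(j := x j + of_real t * v))) has_vector_derivative g x) (at 0)))"

definition smooth_on :: "nat \<Rightarrow> cvec set \<Rightarrow> (cvec \<Rightarrow> complex) \<Rightarrow> bool"
  where "smooth_on n U f \<longleftrightarrow> (\<forall>k. Ck_on n k U f)"


text \<open>A chart is its domain together with its coordinate map.\<close>

type_synonym 'p chart = "'p set \<times> ('p \<Rightarrow> cvec)"

definition chart_inv :: "'p chart \<Rightarrow> cvec \<Rightarrow> 'p"
  where "chart_inv c = inv_into (fst c) (snd c)"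

definition is_chart :: "nat \<Rightarrow> 'p topology \<Rightarrow> 'p chart \<Rightarrow> bool"
  where "is_chart n X c \<longleftrightarrow>
    openin X (fst c) \<and>
    openin (top_of_set (cspace n)) (snd c ` fst c) \<and>
    homeomorphic_map (subtopology X (fst c)) (top_of_set (snd c ` fst c)) (snd c)"

definition complex_manifold :: "nat \<Rightarrow> 'p topology \<Rightarrow> 'p chart set \<Rightarrow> bool"
  where "complex_manifold n X A \<longleftrightarrow>
    Hausdorff_space X \<and> second_countable X \<and>
    (\<forall>c\<in>A. is_chart n X c) \<and>
    (\<Union>c\<in>A. fst c) = topspace X \<and>
    (\<forall>c\<in>A. \<forall>d\<in>A. \<forall>k<n.
      cn_holomorphic_on n (snd c ` (fst c \<inter> fst d)) (\<lambda>x. snd d (chart_inv c x) k))"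

definition compact_complex_manifold :: "nat \<Rightarrow> 'p topology \<Rightarrow> 'p chart set \<Rightarrow> bool"
  where "compact_complex_manifold n X A \<longleftrightarrow> complex_manifold n X A \<and> compact_space X"

text \<open>\<open>jacobian c d p k i\<close> is the \<open>(k, i)\<close> entry of the Jacobian matrix at \<open>p\<close> of the change from \<open>c\<close> to \<open>d\<close>.\<close>

definition jacobian :: "'p chart \<Rightarrow> 'p chart \<Rightarrow> 'p \<Rightarrow> nat \<Rightarrow> nat \<Rightarrow> complex"
  where "jacobian c d p k i = cpartial i (\<lambda>x. snd d (chart_inv c x) k) (snd c p)"


text \<open>
  A (holomorphic) tangent vector at \<open>p\<close> is the family of its coordinate vectors in all charts of the
  atlas around \<open>p\<close>, related by the Jacobians; it is zero at every other argument so that equality of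
  tangent vectors is equality of functions. The vector space operations are pointwise.
\<close>

type_synonym 'p tangent = "'p chart \<Rightarrow> cvec"

definition tangent_space :: "nat \<Rightarrow> 'p chart set \<Rightarrow> 'p \<Rightarrow> 'p tangent set"
  where "tangent_space n A p = {v.
    (\<forall>c\<in>A. p \<in> fst c \<longrightarrow> v c \<in> cspace n) \<and>
    (\<forall>c\<in>A. \<forall>d\<in>A. p \<in> fst c \<inter> fst d \<longrightarrow>
      (\<forall>k<n. v d k = (\<Sum>i<n. jacobian c d p k i * v c i))) \<and>
    (\<forall>c. \<not> (c \<in> A \<and> p \<in> fst c) \<longrightarrow> v c = (\<lambda>i. 0))}"

definition coordinate_vector :: "nat \<Rightarrow> 'p chart set \<Rightarrow> 'p chart \<Rightarrow> nat \<Rightarrow> 'p \<Rightarrow> 'p tangent"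
  where "coordinate_vector n A c i p =
    (\<lambda>d k. if d \<in> A \<and> p \<in> fst d \<and> k < n then jacobian c d p k i else 0)"

type_synonym 'p metric_tensor = "'p \<Rightarrow> 'p tangent \<Rightarrow> 'p tangent \<Rightarrow> complex"

definition hermitian_metric :: "nat \<Rightarrow> 'p topology \<Rightarrow> 'p chart set \<Rightarrow> 'p metric_tensor \<Rightarrow> bool"
  where "hermitian_metric n X A h \<longleftrightarrow>
    (\<forall>p\<in>topspace X.
      (\<forall>u\<in>tangent_space n A p. \<forall>v\<in>tangent_space n A p. \<forall>w\<in>tangent_space n A p.
        h p (\<lambda>c i. u c i + v c i) w = h p u w + h p v w) \<and>
      (\<forall>a. \<forall>u\<in>tangent_space n A p. \<forall>v\<in>tangent_space n A p.
        h p (\<lambda>c i. a * u c i) v = a * h p u v) \<and>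
      (\<forall>u\<in>tangent_space n A p. \<forall>v\<in>tangent_space n A p. h p v u = cnj (h p u v)) \<and>
      (\<forall>v\<in>tangent_space n A p. v \<noteq> (\<lambda>c i. 0) \<longrightarrow> 0 < Re (h p v v))) \<and>
    (\<forall>c\<in>A. \<forall>i<n. \<forall>j<n. smooth_on n (snd c ` fst c)
      (\<lambda>x. h (chart_inv c x) (coordinate_vector n A c i (chart_inv c x))
                             (coordinate_vector n A c j (chart_inv c x))))"

definition metric_norm :: "'p metric_tensor \<Rightarrow> 'p \<Rightarrow> 'p tangent \<Rightarrow> real"
  where "metric_norm h p v = sqrt (Re (h p v v))"


definition holomorphic_curve :: "nat \<Rightarrow> 'p topology \<Rightarrow> 'p chart set \<Rightarrow> (complex \<Rightarrow> 'p) \<Rightarrow> bool"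
  where "holomorphic_curve n X A f \<longleftrightarrow>
    continuous_map euclidean X f \<and>
    (\<forall>c\<in>A. \<forall>i<n. (\<lambda>z. snd c (f z) i) holomorphic_on (f -` fst c))"

text \<open>The differential \<open>Df\<^sub>z\<close>, with \<open>T\<^sub>z\<complex>\<close> identified with \<open>\<complex>\<close>.\<close>

definition differential ::
    "nat \<Rightarrow> 'p chart set \<Rightarrow> (complex \<Rightarrow> 'p) \<Rightarrow> complex \<Rightarrow> complex \<Rightarrow> 'p tangent"
  where "differential n A f z \<zeta> =
    (\<lambda>c i. if c \<in> A \<and> f z \<in> fst c \<and> i < n then deriv (\<lambda>w. snd c (f w) i) z * \<zeta> else 0)"

text \<open>The operator norm, written as in the definition of \<^const>\<open>onorm\<close>.\<close>

definition differential_norm ::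
    "nat \<Rightarrow> 'p chart set \<Rightarrow> 'p metric_tensor \<Rightarrow> (complex \<Rightarrow> 'p) \<Rightarrow> complex \<Rightarrow> real"
  where "differential_norm n A h f z =
    (SUP \<zeta>. metric_norm h (f z) (differential n A f z \<zeta>) / cmod \<zeta>)"

definition bounded_derivative ::
    "nat \<Rightarrow> 'p chart set \<Rightarrow> 'p metric_tensor \<Rightarrow> (complex \<Rightarrow> 'p) \<Rightarrow> bool"
  where "bounded_derivative n A h f \<longleftrightarrow> (\<exists>C>0. \<forall>z. differential_norm n A h f z < C)"

end

theory Submission
  imports Defs "HOL-Complex_Analysis.Cauchy_Integral_Formula"
begin

text \<open>
  Let \<open>T\<close> be the square of the elliptic curve \<open>\<complex> / \<int>[\<i>]\<close> with its flat metric. By Liouville's theorem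
  an entire curve in \<open>T\<close> with bounded derivative is an affine line. The entire function
  \<open>g(z) = exp (- exp (2 \<pi> z)) / 8\<close> is bounded by \<open>1/8\<close> on the horizontal strips where
  \<open>cos (2 \<pi> Im z) \<ge> 0\<close>. These strips are invariant under the lattice, so the union \<open>\<Omega>\<^sub>1\<close> of
  \<open>{(z, w). cos (2 \<pi> Im z) < 0}\<close> and of a thin tube around the graph of \<open>g\<close> is not dense. It is
  filled by vertical lines and by translates of the graph.

  Over the strips the closure of \<open>\<Omega>\<^sub>1\<close> has only small values of \<open>w\<close>. Restricting to a real line inside
  a strip, every line in this closure is therefore vertical over a point outside the strips, or
  horizontal. Near \<open>z = 1/2\<close> modulo the lattice all values of \<open>g\<close> are close to \<open>0\<close> or to \<open>1/8\<close>, because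
  \<open>exp (- exp (2 \<pi> x))\<close> jumps from \<open>1\<close> to \<open>0\<close> within one period; so the height of a
  horizontal line is close to \<open>0\<close> or to \<open>1/8\<close>. But \<open>g(0) = 1 / (8 e)\<close> is close to neither, and removing
  from \<open>\<Omega>\<^sub>1\<close> a closed neighbourhood of \<open>(0, g(0))\<close> gives \<open>\<Omega>\<^sub>2\<close>.
\<close>

lemma cis_2pi_eq_iff: "cis (2 * pi * s) = cis (2 * pi * t) \<longleftrightarrow> s - t \<in> \<int>"
proof -
  have "cis (2 * pi * s) = cis (2 * pi * t) \<longleftrightarrow> (\<exists>n::int. 2 * pi * s = 2 * pi * t + 2 * pi * n)"
    unfolding sin_cos_eq_iff [symmetric] by (auto simp: complex_eq_iff)
  also have "\<dots> \<longleftrightarrow> (\<exists>n::int. s - t = n)"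
  proof (intro iff_exI)
    fix n :: int
    have "2 * pi * s = 2 * pi * t + 2 * pi * n \<longleftrightarrow> 2 * pi * s = 2 * pi * (t + n)"
      by (simp add: distrib_left)
    also have "\<dots> \<longleftrightarrow> s = t + n" by simp
    finally show "2 * pi * s = 2 * pi * t + 2 * pi * n \<longleftrightarrow> s - t = n" by linarith
  qed
  finally show ?thesis by (auto elim: Ints_cases)
qed

section \<open>The torus as a complex manifold\<close>

text \<open>
  The torus \<open>\<complex>\<^sup>n / \<int>[\<i>]\<^sup>n\<close> is realised as \<open>(S\<^sup>1)\<^sup>2\<^sup>n\<close>: coordinate \<open>j < n\<close> carries the real part and
  coordinate \<open>n + j\<close> the imaginary part of the \<open>j\<close>-th variable.
\<close>

definition torus_proj :: "nat \<Rightarrow> cvec \<Rightarrow> cvec"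
  where "torus_proj n x = (\<lambda>j. if j < n then cis (2 * pi * Re (x j))
    else if j < 2 * n then cis (2 * pi * Im (x (j - n))) else 0)"

definition torus :: "nat \<Rightarrow> cvec set"
  where "torus n = torus_proj n ` cspace n"

section \<open>Topology of the torus: compactness and openness of the projection\<close>

lemma continuous_on_coordinate [continuous_intros]:
  "continuous_on S (\<lambda>x :: 'a \<Rightarrow> 'b::topological_space. x i)"
  by (rule continuous_on_product_then_coordinatewise [OF continuous_on_id, simplified])

lemma continuous_on_torus_proj: "continuous_on S (torus_proj n)"
proof (rule continuous_on_coordinatewise_then_product)
  fix j
  show "continuous_on S (\<lambda>x. torus_proj n x j)"
    unfolding torus_proj_def by (cases "j < n"; cases "j < 2 * n"; simp; intro continuous_intros)
qed

lemma torus_proj_eq_iff: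
  "torus_proj n x = torus_proj n y \<longleftrightarrow>
    (\<forall>i<n. Re (x i) - Re (y i) \<in> \<int> \<and> Im (x i) - Im (y i) \<in> \<int>)"
proof
  assume eq: "torus_proj n x = torus_proj n y"
  show "\<forall>i<n. Re (x i) - Re (y i) \<in> \<int> \<and> Im (x i) - Im (y i) \<in> \<int>"
  proof (intro allI impI)
    fix i assume "i < n"
    with fun_cong [OF eq, of i] fun_cong [OF eq, of "n + i"]
    show "Re (x i) - Re (y i) \<in> \<int> \<and> Im (x i) - Im (y i) \<in> \<int>"
      by (simp add: torus_proj_def cis_2pi_eq_iff)
  qed
qed (auto simp: torus_proj_def fun_eq_iff cis_2pi_eq_iff)

lemma torus_proj_in_torus: "torus_proj n x \<in> torus n"
proof -
  have "torus_proj n x = torus_proj n (\<lambda>i. if i < n then x i else 0)"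
    by (simp add: torus_proj_eq_iff)
  then show ?thesis by (auto simp: torus_def cspace_def)
qed

lemma Ints_small_eq_0: "\<bar>x\<bar> < 1 \<Longrightarrow> x \<in> \<int> \<Longrightarrow> x = (0::real)"
  by (auto elim!: Ints_cases)

text \<open>Tychonoff's theorem applies once the cube is written as a product over all of
  \<open>nat\<close>, with the factor \<open>{0}\<close> from index \<open>n\<close> on.\<close>

lemma compact_unit_cube:
  "compact {x \<in> cspace n. \<forall>i<n. x i \<in> cbox 0 (1 + \<i>)}"
proof -
  have "{x \<in> cspace n. \<forall>i<n. x i \<in> cbox 0 (1 + \<i>)} =
      Pi\<^sub>E UNIV (\<lambda>i. if i < n then cbox 0 (1 + \<i>) else {0})"
    unfolding cspace_def PiE_UNIV_domain Pi_def by (auto simp: not_less split: if_split_asm)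
  moreover have "compactin (product_topology (\<lambda>i. euclidean) UNIV)
      (Pi\<^sub>E UNIV (\<lambda>i. if i < n then cbox 0 (1 + \<i>) else {0 :: complex}))"
    unfolding compactin_PiE by (simp add: compact_cbox)
  ultimately show ?thesis
    by (simp add: euclidean_product_topology flip: compactin_euclidean_iff)
qed

lemma torus_eq_image_cube:
  "torus n = torus_proj n ` {x \<in> cspace n. \<forall>i<n. x i \<in> cbox 0 (1 + \<i>)}"
proof
  show "torus n \<subseteq> torus_proj n ` {x \<in> cspace n. \<forall>i<n. x i \<in> cbox 0 (1 + \<i>)}"
  proof
    fix p assume "p \<in> torus n"
    then obtain x where x: "x \<in> cspace n" "p = torus_proj n x" by (auto simp: torus_def)
    define y where "y = (\<lambda>i. Complex (frac (Re (x i))) (frac (Im (x i))))"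
    have "y \<in> cspace n" using x by (simp add: y_def cspace_def complex_eq_iff)
    moreover have "\<forall>i<n. y i \<in> cbox 0 (1 + \<i>)"
      by (auto simp: y_def in_cbox_complex_iff frac_lt_1 less_imp_le)
    moreover have "p = torus_proj n y"
      unfolding x torus_proj_eq_iff by (simp add: y_def frac_def)
    ultimately show "p \<in> torus_proj n ` {x \<in> cspace n. \<forall>i<n. x i \<in> cbox 0 (1 + \<i>)}" by blast
  qed
qed (auto simp: torus_def)

lemma compact_torus: "compact (torus n)"
  unfolding torus_eq_image_cube
  by (intro compact_continuous_image compact_unit_cube continuous_on_torus_proj)

text \<open>The torus carries the quotient topology: the complement of \<open>S\<close> is the image
  of the part of the compact cube outside the open preimage, hence compact and closed.\<close>

lemma openin_torus:
  assumes "S \<subseteq> torus n" "openin (top_of_set (cspace n)) {x \<in> cspace n. torus_proj n x \<in> S}"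
  shows "openin (top_of_set (torus n)) S"
proof -
  let ?Q = "{x \<in> cspace n. \<forall>i<n. x i \<in> cbox 0 (1 + \<i>)}"
  from assms(2) obtain U where U: "open U" "{x \<in> cspace n. torus_proj n x \<in> S} = cspace n \<inter> U"
    by (auto simp: openin_open)
  have "torus n - S = torus_proj n ` (?Q - U)"
  proof -
    have "torus_proj n x \<in> S \<longleftrightarrow> x \<in> U" if "x \<in> ?Q" for x using U that by blast
    then show ?thesis by (subst torus_eq_image_cube) blast
  qed
  moreover have "compact (torus_proj n ` (?Q - U))"
    by (intro compact_continuous_image compact_diff compact_unit_cube continuous_on_torus_proj U)
  ultimately have "closed (torus n - S)" by (simp only: compact_imp_closed)
  then have "closedin (top_of_set (torus n)) (torus n - S)" by (simp add: closed_subset)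
  then show ?thesis using assms(1) by (simp add: openin_closedin_eq)
qed

text \<open>The saturation of \<open>S\<close> is the union of its translates by the lattice
  \<open>L\<close>, and each translate is open.\<close>

lemma open_map_torus_proj: "open_map (top_of_set (cspace n)) (top_of_set (torus n)) (torus_proj n)"
  unfolding open_map_def
proof (intro allI impI)
  fix S assume S: "openin (top_of_set (cspace n)) S"
  then obtain U where U: "open U" "S = cspace n \<inter> U" by (auto simp: openin_open)
  define L where "L = {m :: cvec. m \<in> cspace n \<and> (\<forall>i<n. Re (m i) \<in> \<int> \<and> Im (m i) \<in> \<int>)}"
  have "open ((\<lambda>x i. x i + m i) -` U)" for m :: cvec
    by (rule open_vimage [OF U(1)]) (intro continuous_intros)
  then have "openin (top_of_set (cspace n)) (cspace n \<inter> (\<Union>m\<in>L. (\<lambda>x i. x i + m i) -` U))"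
    by (intro openin_open_Int open_UN ballI)
  moreover have "{x \<in> cspace n. torus_proj n x \<in> torus_proj n ` S} =
      cspace n \<inter> (\<Union>m\<in>L. (\<lambda>x i. x i + m i) -` U)"
  proof (intro equalityI subsetI)
    fix x assume "x \<in> {x \<in> cspace n. torus_proj n x \<in> torus_proj n ` S}"
    then obtain y where x: "x \<in> cspace n" and y: "y \<in> cspace n" "y \<in> U"
      and "torus_proj n y = torus_proj n x" using U by force
    then have "(\<lambda>i. y i - x i) \<in> L" by (auto simp: L_def cspace_def torus_proj_eq_iff)
    moreover have "(\<lambda>i. x i + (y i - x i)) \<in> U" using y by simp
    ultimately show "x \<in> cspace n \<inter> (\<Union>m\<in>L. (\<lambda>x i. x i + m i) -` U)" using x by blast
  next
    fix x assume "x \<in> cspace n \<inter> (\<Union>m\<in>L. (\<lambda>x i. x i + m i) -` U)"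
    then obtain m where m: "x \<in> cspace n" "m \<in> L" "(\<lambda>i. x i + m i) \<in> U" by blast
    then have "(\<lambda>i. x i + m i) \<in> S" by (auto simp: U L_def cspace_def)
    moreover have "torus_proj n x = torus_proj n (\<lambda>i. x i + m i)"
      using m(2) by (auto simp: torus_proj_eq_iff L_def)
    ultimately show "x \<in> {x \<in> cspace n. torus_proj n x \<in> torus_proj n ` S}" using m by blast
  qed
  ultimately show "openin (top_of_set (torus n)) (torus_proj n ` S)"
    by (intro openin_torus) (auto intro: torus_proj_in_torus)
qed

section \<open>Charts and their transition maps\<close>

definition box_around :: "nat \<Rightarrow> cvec \<Rightarrow> cvec set"
  where "box_around n a =
    {x \<in> cspace n. \<forall>i<n. \<bar>Re (x i) - Re (a i)\<bar> < 1/4 \<and> \<bar>Im (x i) - Im (a i)\<bar> < 1/4}"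

definition torus_chart :: "nat \<Rightarrow> cvec \<Rightarrow> cvec chart"
  where "torus_chart n a =
    (torus_proj n ` box_around n a, inv_into (box_around n a) (torus_proj n))"

definition torus_atlas :: "nat \<Rightarrow> cvec chart set"
  where "torus_atlas n = torus_chart n ` cspace n"

text \<open>Points of one box differ by less than 1/2 in each real coordinate; if their images
  agree, these differences are integers and therefore vanish.\<close>

lemma inj_on_torus_proj_box: "inj_on (torus_proj n) (box_around n a)"
proof (rule inj_onI)
  fix x y assume x: "x \<in> box_around n a" and y: "y \<in> box_around n a"
    and "torus_proj n x = torus_proj n y"
  then have I: "Re (x i) - Re (y i) \<in> \<int>" "Im (x i) - Im (y i) \<in> \<int>" if "i < n" for i
    using that by (auto simp: torus_proj_eq_iff)
  show "x = y"
  proof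
    fix i
    show "x i = y i"
    proof (cases "i < n")
      case True
      have "\<bar>Re (x i) - Re (a i)\<bar> < 1/4" "\<bar>Im (x i) - Im (a i)\<bar> < 1/4"
        "\<bar>Re (y i) - Re (a i)\<bar> < 1/4" "\<bar>Im (y i) - Im (a i)\<bar> < 1/4"
        using x y True by (auto simp: box_around_def)
      then have "\<bar>Re (x i) - Re (y i)\<bar> < 1" "\<bar>Im (x i) - Im (y i)\<bar> < 1" by linarith+
      then show ?thesis using I [OF True] Ints_small_eq_0 by (fastforce simp: complex_eq_iff)
    qed (use x y in \<open>simp add: box_around_def cspace_def\<close>)
  qed
qed

lemma snd_torus_chart [simp]:
  "x \<in> box_around n a \<Longrightarrow> snd (torus_chart n a) (torus_proj n x) = x"
  by (simp add: torus_chart_def inv_into_f_f inj_on_torus_proj_box)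

lemma snd_torus_chart_in_box:
  "p \<in> fst (torus_chart n a) \<Longrightarrow> snd (torus_chart n a) p \<in> box_around n a"
  by (simp add: torus_chart_def inv_into_into)

lemma torus_proj_torus_chart:
  "p \<in> fst (torus_chart n a) \<Longrightarrow> torus_proj n (snd (torus_chart n a) p) = p"
  by (simp add: torus_chart_def f_inv_into_f)

lemma snd_torus_chart_image: "snd (torus_chart n a) ` fst (torus_chart n a) = box_around n a"
  by (force simp: snd_torus_chart_in_box image_iff torus_chart_def inv_into_f_f inj_on_torus_proj_box)

lemma chart_inv_torus_chart:
  assumes "x \<in> box_around n a"
  shows "chart_inv (torus_chart n a) x = torus_proj n x"
proof -
  have "inj_on (snd (torus_chart n a)) (fst (torus_chart n a))"
    by (metis inj_on_inverseI torus_proj_torus_chart)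
  moreover have "torus_proj n x \<in> fst (torus_chart n a)" using assms by (simp add: torus_chart_def)
  ultimately show ?thesis
    unfolding chart_inv_def using assms by (metis inv_into_f_f snd_torus_chart)
qed

lemma openin_box_around: "openin (top_of_set (cspace n)) (box_around n a)"
proof -
  have "open (\<Inter>i\<in>{..<n}. {x :: cvec. \<bar>Re (x i) - Re (a i)\<bar> < 1/4} \<inter>
      {x. \<bar>Im (x i) - Im (a i)\<bar> < 1/4})"
    by (intro open_INT open_Int ballI open_Collect_less continuous_intros finite_lessThan)
  moreover have "box_around n a = cspace n \<inter> (\<Inter>i\<in>{..<n}.
      {x :: cvec. \<bar>Re (x i) - Re (a i)\<bar> < 1/4} \<inter> {x. \<bar>Im (x i) - Im (a i)\<bar> < 1/4})"
    by (auto simp: box_around_def)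
  ultimately show ?thesis by (auto simp: openin_open)
qed

lemma is_chart_torus_chart: "is_chart n (top_of_set (torus n)) (torus_chart n a)"
  unfolding is_chart_def snd_torus_chart_image
proof (intro conjI openin_box_around)
  let ?B = "box_around n a" and ?U = "fst (torus_chart n a)"
  have U: "?U = torus_proj n ` ?B" by (simp add: torus_chart_def)
  show *: "openin (top_of_set (torus n)) ?U"
    using open_map_torus_proj openin_box_around unfolding open_map_def U by blast
  have sub: "subtopology (top_of_set (torus n)) ?U = top_of_set ?U"
    using openin_imp_subset [OF *] by (simp add: subtopology_subtopology Int_absorb1)
  have "openin (top_of_set ?U) (torus_proj n ` V)" if V: "openin (top_of_set ?B) V" for V
  proof -
    have "openin (top_of_set (cspace n)) V" using V openin_box_around openin_trans by blast
    then have "openin (top_of_set (torus n)) (torus_proj n ` V)"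
      using open_map_torus_proj unfolding open_map_def by blast
    moreover have "torus_proj n ` V \<subseteq> ?U" unfolding U using openin_imp_subset [OF V] by blast
    ultimately show ?thesis
      using openin_imp_subset [OF *] by (meson openin_subset_trans)
  qed
  then have "homeomorphic_map (top_of_set ?B) (top_of_set ?U) (torus_proj n)"
    by (intro bijective_open_imp_homeomorphic_map)
      (auto simp: continuous_on_torus_proj inj_on_torus_proj_box open_map_def U)
  then obtain g where g: "homeomorphic_maps (top_of_set ?B) (top_of_set ?U) (torus_proj n) g"
    by (auto simp: homeomorphic_map_maps)
  then have "homeomorphic_map (top_of_set ?U) (top_of_set ?B) g"
    by (simp add: homeomorphic_maps_map)
  moreover have "g p = snd (torus_chart n a) p" if "p \<in> ?U" for p
    using that g unfolding U homeomorphic_maps_map by auto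
  ultimately show "homeomorphic_map (subtopology (top_of_set (torus n)) ?U) (top_of_set ?B)
      (snd (torus_chart n a))"
    unfolding sub using homeomorphic_map_eq by fastforce
qed

text \<open>
  The boxes have side \<open>1/2\<close>, so the change of coordinates is the same lattice translation on the whole
  overlap.
\<close>

lemma torus_chart_change:
  obtains m where "\<And>p i. p \<in> fst (torus_chart n a) \<Longrightarrow> p \<in> fst (torus_chart n b) \<Longrightarrow>
    snd (torus_chart n b) p i = snd (torus_chart n a) p i - m i"
proof (cases "fst (torus_chart n a) \<inter> fst (torus_chart n b) = {}")
  case True
  then show ?thesis using that by blast
next
  case False
  let ?s = "snd (torus_chart n a)" and ?t = "snd (torus_chart n b)"
  from False obtain q where q: "q \<in> fst (torus_chart n a)" "q \<in> fst (torus_chart n b)" by blast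
  show ?thesis
  proof (rule that)
    fix p i assume p: "p \<in> fst (torus_chart n a)" "p \<in> fst (torus_chart n b)"
    note box = snd_torus_chart_in_box [OF p(1)] snd_torus_chart_in_box [OF p(2)]
      snd_torus_chart_in_box [OF q(1)] snd_torus_chart_in_box [OF q(2)]
    have "torus_proj n (?s p) = torus_proj n (?t p)" "torus_proj n (?s q) = torus_proj n (?t q)"
      using p q by (simp_all add: torus_proj_torus_chart)
    \<comment> \<open>The translation is read off at one common point \<open>q\<close>. The
      difference of the offsets at \<open>p\<close> and \<open>q\<close> is an integer; regrouped as
      \<open>(?s p i - ?s q i) - (?t p i - ?t q i)\<close> it is a difference of two terms whose
      real and imaginary parts are below 1/2 in modulus, so it vanishes.\<close>
    then have int: "Re (?s p i) - Re (?t p i) - (Re (?s q i) - Re (?t q i)) \<in> \<int>"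
        "Im (?s p i) - Im (?t p i) - (Im (?s q i) - Im (?t q i)) \<in> \<int>" if "i < n"
      using that unfolding torus_proj_eq_iff by (meson Ints_diff)+
    show "?t p i = ?s p i - (?s q i - ?t q i)"
    proof (cases "i < n")
      case True
      then have "\<bar>Re (?s p i) - Re (a i)\<bar> < 1/4" "\<bar>Im (?s p i) - Im (a i)\<bar> < 1/4"
        "\<bar>Re (?t p i) - Re (b i)\<bar> < 1/4" "\<bar>Im (?t p i) - Im (b i)\<bar> < 1/4"
        "\<bar>Re (?s q i) - Re (a i)\<bar> < 1/4" "\<bar>Im (?s q i) - Im (a i)\<bar> < 1/4"
        "\<bar>Re (?t q i) - Re (b i)\<bar> < 1/4" "\<bar>Im (?t q i) - Im (b i)\<bar> < 1/4"
        using box by (simp_all add: box_around_def)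
      then have "\<bar>Re (?s p i) - Re (?t p i) - (Re (?s q i) - Re (?t q i))\<bar> < 1"
          "\<bar>Im (?s p i) - Im (?t p i) - (Im (?s q i) - Im (?t q i))\<bar> < 1"
        unfolding abs_less_iff by linarith+
      then have "Re (?s p i) - Re (?t p i) - (Re (?s q i) - Re (?t q i)) = 0"
          "Im (?s p i) - Im (?t p i) - (Im (?s q i) - Im (?t q i)) = 0"
        using int [OF True] Ints_small_eq_0 by blast+
      then show ?thesis by (simp add: complex_eq_iff)
    qed (use box in \<open>simp add: box_around_def cspace_def\<close>)
  qed
qed

text \<open>The derivative is the \<open>k\<close>-th coordinate functional, and with it the
  difference quotient is exactly 0 on \<open>U\<close>, not merely in the limit.\<close>

lemma cn_holomorphic_on_translation:
  assumes "k < n" "\<And>x. x \<in> U \<Longrightarrow> f x = x k - m"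
  shows "cn_holomorphic_on n U f"
  unfolding cn_holomorphic_on_def
proof
  fix x assume x: "x \<in> U"
  have "(\<Sum>i<n. (if i = k then 1 else 0) * (y i - x i)) = y k - x k" for y :: cvec
    using assms(1) by (simp add: if_distrib [of "\<lambda>c. c * _"] cong: if_cong)
  then have "\<forall>\<^sub>F y in at x within U. (f y - f x - (\<Sum>i<n. (if i = k then 1 else 0) * (y i - x i))) /
      of_real (cnorm n (\<lambda>i. y i - x i)) = 0"
    using x by (simp add: eventually_at_filter assms(2))
  then show "\<exists>a. ((\<lambda>y. (f y - f x - (\<Sum>i<n. a i * (y i - x i))) / of_real (cnorm n (\<lambda>i. y i - x i)))
      \<longlongrightarrow> 0) (at x within U)"
    by (intro exI [of _ "\<lambda>i. if i = k then 1 else 0"] tendsto_eventually)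
qed

lemma chart_inv_image_torus_chart:
  assumes "x \<in> snd (torus_chart n a) ` S" "S \<subseteq> fst (torus_chart n a)"
  shows "chart_inv (torus_chart n a) x \<in> S" "snd (torus_chart n a) (chart_inv (torus_chart n a) x) = x"
proof -
  obtain p where p: "p \<in> S" "x = snd (torus_chart n a) p" "p \<in> fst (torus_chart n a)"
    using assms by blast
  then have "chart_inv (torus_chart n a) x = p"
    by (simp add: chart_inv_torus_chart snd_torus_chart_in_box torus_proj_torus_chart)
  with p show "chart_inv (torus_chart n a) x \<in> S"
    "snd (torus_chart n a) (chart_inv (torus_chart n a) x) = x" by simp_all
qed

lemma second_countable_euclidean: "second_countable (euclidean :: 'a::second_countable_topology topology)"
proof -
  obtain B :: "'a set set" where B: "countable B" "topological_basis B"
    using ex_countable_basis by blast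
  show ?thesis
    unfolding second_countable_def
  proof (intro exI [of _ B] conjI allI impI ballI)
    show "\<exists>V\<in>B. x \<in> V \<and> V \<subseteq> U" if "openin euclidean U \<and> x \<in> U" for U x
      using that topological_basisE [OF B(2), of U x] by (metis open_openin)
  qed (use B topological_basis_open in auto)
qed

lemma UN_torus_atlas: "(\<Union>c\<in>torus_atlas n. fst c) = torus n"
proof
  show "(\<Union>c\<in>torus_atlas n. fst c) \<subseteq> torus n"
    by (auto simp: torus_atlas_def torus_chart_def torus_proj_in_torus)
  show "torus n \<subseteq> (\<Union>c\<in>torus_atlas n. fst c)"
  proof
    fix p assume "p \<in> torus n"
    then obtain x where "x \<in> cspace n" "p = torus_proj n x" by (auto simp: torus_def)
    moreover from this have "x \<in> box_around n x" by (simp add: box_around_def)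
    ultimately show "p \<in> (\<Union>c\<in>torus_atlas n. fst c)"
      by (auto simp: torus_atlas_def torus_chart_def)
  qed
qed

lemma compact_complex_manifold_torus:
  "compact_complex_manifold n (top_of_set (torus n)) (torus_atlas n)"
  unfolding compact_complex_manifold_def complex_manifold_def
proof (intro conjI ballI allI impI)
  show "Hausdorff_space (top_of_set (torus n))"
    by (simp add: Hausdorff_space_subtopology)
  show "second_countable (top_of_set (torus n))"
    by (simp add: second_countable_euclidean second_countable_subtopology)
  show "is_chart n (top_of_set (torus n)) c" if "c \<in> torus_atlas n" for c
    using that is_chart_torus_chart by (auto simp: torus_atlas_def)
  show "(\<Union>c\<in>torus_atlas n. fst c) = topspace (top_of_set (torus n))"
    by (simp add: UN_torus_atlas)
  show "compact_space (top_of_set (torus n))"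
    by (simp add: compact_space_subtopology compact_torus)
next
  fix c d k
  assume "c \<in> torus_atlas n" "d \<in> torus_atlas n" and k: "k < n"
  then obtain a b where c: "c = torus_chart n a" and d: "d = torus_chart n b"
    by (auto simp: torus_atlas_def)
  obtain m where m: "\<And>p i. p \<in> fst c \<Longrightarrow> p \<in> fst d \<Longrightarrow> snd d p i = snd c p i - m i"
    unfolding c d by (rule torus_chart_change) blast
  show "cn_holomorphic_on n (snd c ` (fst c \<inter> fst d)) (\<lambda>x. snd d (chart_inv c x) k)"
  proof (rule cn_holomorphic_on_translation [OF k])
    fix x assume x: "x \<in> snd c ` (fst c \<inter> fst d)"
    then have "chart_inv c x \<in> fst c \<inter> fst d" "snd c (chart_inv c x) = x"
      using chart_inv_image_torus_chart [of x n a "fst c \<inter> fst d"] by (auto simp: c)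
    then show "snd d (chart_inv c x) k = x k - m k" using m by simp
  qed
qed

section \<open>Jacobians and the flat metric\<close>

lemma open_vimage_fun_upd:
  fixes x :: cvec
  assumes "openin (top_of_set (cspace n)) U" "x \<in> cspace n" "i < n"
  shows "open {w. x(i := w) \<in> U}"
proof -
  obtain V where V: "open V" "U = cspace n \<inter> V" using assms(1) by (auto simp: openin_open)
  have "continuous_on UNIV (\<lambda>w. x(i := w))"
  proof (rule continuous_on_coordinatewise_then_product)
    show "continuous_on UNIV (\<lambda>w. (x(i := w)) j)" for j
      by (cases "j = i") simp_all
  qed
  then have "open ((\<lambda>w. x(i := w)) -` V)" using V by (intro open_vimage)
  moreover have "x(i := w) \<in> cspace n" for w using assms by (auto simp: cspace_def)
  ultimately show ?thesis by (simp add: V vimage_def)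
qed

lemma openin_torus_chart_overlap:
  "openin (top_of_set (cspace n))
    (snd (torus_chart n a) ` (fst (torus_chart n a) \<inter> fst (torus_chart n b)))"
proof -
  have "openin (top_of_set (box_around n a))
      (snd (torus_chart n a) ` (fst (torus_chart n a) \<inter> fst (torus_chart n b)))"
  proof (rule homeomorphic_imp_open_map [unfolded open_map_def, rule_format])
    show "homeomorphic_map (subtopology (top_of_set (torus n)) (fst (torus_chart n a)))
        (top_of_set (box_around n a)) (snd (torus_chart n a))"
      using is_chart_torus_chart [of n a] unfolding is_chart_def snd_torus_chart_image by blast
    show "openin (subtopology (top_of_set (torus n)) (fst (torus_chart n a)))
        (fst (torus_chart n a) \<inter> fst (torus_chart n b))"
      using is_chart_torus_chart [of n b] unfolding is_chart_def
      by (auto simp: openin_subtopology_Int2)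
  qed
  then show ?thesis using openin_box_around openin_trans by blast
qed

text \<open>On the coordinate line in direction \<open>i\<close> the change of charts agrees near
  \<open>x i\<close> with a translation, so every Jacobian is the identity matrix.\<close>

lemma jacobian_torus:
  assumes "c \<in> torus_atlas n" "d \<in> torus_atlas n" "p \<in> fst c" "p \<in> fst d" "i < n"
  shows "jacobian c d p k i = (if k = i then 1 else 0)"
proof -
  obtain a b where c: "c = torus_chart n a" and d: "d = torus_chart n b"
    using assms by (auto simp: torus_atlas_def)
  obtain m where m: "\<And>p i. p \<in> fst c \<Longrightarrow> p \<in> fst d \<Longrightarrow> snd d p i = snd c p i - m i"
    unfolding c d by (rule torus_chart_change) blast
  define x where "x = snd c p"
  let ?V = "snd c ` (fst c \<inter> fst d)"
  have x: "x \<in> cspace n"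
    using snd_torus_chart_in_box assms(3) by (auto simp: x_def c box_around_def)
  have op: "open {w. x(i := w) \<in> ?V}"
    using open_vimage_fun_upd [OF _ x assms(5)] openin_torus_chart_overlap by (simp add: c d)
  have eq: "(x(i := w)) k - m k = snd d (chart_inv c (x(i := w))) k" if "w \<in> {w. x(i := w) \<in> ?V}" for w
    using that m chart_inv_image_torus_chart [of "x(i := w)" n a "fst c \<inter> fst d"] by (auto simp: c)
  have "((\<lambda>w. (x(i := w)) k - m k) has_field_derivative (if k = i then 1 else 0)) (at (x i))"
    by (auto intro!: derivative_eq_intros)
  then have "((\<lambda>w. snd d (chart_inv c (x(i := w))) k) has_field_derivative (if k = i then 1 else 0)) (at (x i))"
    by (rule has_field_derivative_transform_within_open [OF _ op _ eq])
      (use assms in \<open>auto simp: x_def\<close>)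
  then show ?thesis
    unfolding jacobian_def cpartial_def x_def by (rule DERIV_imp_deriv)
qed

text \<open>On the torus all Jacobians are the identity, so a tangent vector has the same
  coordinates in every chart around \<open>p\<close>, and the value does not depend on the chart
  picked by \<open>SOME\<close>.\<close>

definition flat_metric :: "nat \<Rightarrow> 'p chart set \<Rightarrow> 'p metric_tensor"
  where "flat_metric n A p u v =
    (let c = (SOME c. c \<in> A \<and> p \<in> fst c) in \<Sum>i<n. u c i * cnj (v c i))"

lemma some_torus_chart:
  assumes "p \<in> torus n"
  shows "(SOME c. c \<in> torus_atlas n \<and> p \<in> fst c) \<in> torus_atlas n \<and>
    p \<in> fst (SOME c. c \<in> torus_atlas n \<and> p \<in> fst c)"
proof (rule someI_ex)
  show "\<exists>c. c \<in> torus_atlas n \<and> p \<in> fst c"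
    using assms UN_torus_atlas [of n] by blast
qed

text \<open>Openness keeps \<open>x(j := x j + of_real t * v)\<close> in \<open>U\<close> for small
  \<open>t\<close>, so the directional derivatives are 0 there. The induction then continues with
  the zero function in place of \<open>f\<close>.\<close>

lemma Ck_on_const:
  assumes "openin (top_of_set (cspace n)) U" "\<And>x. x \<in> U \<Longrightarrow> f x = c"
  shows "Ck_on n k U f"
  using assms(2)
proof (induction k arbitrary: f c)
  case 0
  then show ?case by (simp cong: continuous_on_cong)
next
  case (Suc k)
  have "((\<lambda>t. f (x(j := x j + of_real t * v))) has_vector_derivative 0) (at 0)"
    if "j < n" "x \<in> U" for j v x
  proof -
    have x: "x \<in> cspace n" using openin_imp_subset [OF assms(1)] that by blast
    have "open ((\<lambda>t. x j + of_real t * v) -` {w. x(j := w) \<in> U})"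
      using open_vimage_fun_upd [OF assms(1) x that(1)]
      by (rule open_vimage) (intro continuous_intros)
    then show ?thesis
      by (rule has_vector_derivative_transform_within_open [where f = "\<lambda>_. c", rotated])
        (use that Suc.prems in auto)
  qed
  moreover have "continuous_on U f" using Suc.prems by (simp cong: continuous_on_cong)
  moreover have "Ck_on n k U (\<lambda>_. 0)" by (rule Suc.IH [of _ 0]) simp
  ultimately show ?case unfolding Ck_on.simps by blast
qed

text \<open>Positivity holds because the coordinates of a tangent vector in one chart determine all
  others, so a nonzero vector is nonzero in the chosen chart. Smoothness holds because the
  coefficients in a coordinate frame are the Kronecker delta.\<close>

lemma hermitian_metric_torus:
  "hermitian_metric n (top_of_set (torus n)) (torus_atlas n) (flat_metric n (torus_atlas n))"
  unfolding hermitian_metric_def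
proof (intro conjI ballI allI impI)
  fix p v assume "p \<in> topspace (top_of_set (torus n))"
    and v: "v \<in> tangent_space n (torus_atlas n) p" and nz: "v \<noteq> (\<lambda>c i. 0)"
  then have p: "p \<in> torus n" by simp
  define c where "c = (SOME c. c \<in> torus_atlas n \<and> p \<in> fst c)"
  have c: "c \<in> torus_atlas n" "p \<in> fst c" using some_torus_chart [OF p] by (auto simp: c_def)
  have "\<exists>i<n. v c i \<noteq> 0"
  proof (rule ccontr)
    assume *: "\<not> (\<exists>i<n. v c i \<noteq> 0)"
    have "v d k = 0" for d k
    proof (cases "d \<in> torus_atlas n \<and> p \<in> fst d")
      case True
      show ?thesis
      proof (cases "k < n")
        case k: True
        have "v d k = (\<Sum>i<n. jacobian c d p k i * v c i)"
          using v c True k unfolding tangent_space_def by blast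
        then show ?thesis using * by simp
      next
        case False
        then show ?thesis using v True by (simp add: tangent_space_def cspace_def)
      qed
    next
      case False
      then have "v d = (\<lambda>i. 0)" using v unfolding tangent_space_def by blast
      then show ?thesis by simp
    qed
    then have "v = (\<lambda>c i. 0)" by (intro ext)
    then show False using nz by contradiction
  qed
  then obtain i where "i < n" "v c i \<noteq> 0" by blast
  then have "0 < (\<Sum>i<n. (cmod (v c i))\<^sup>2)" by (intro sum_pos2 [of _ i]) auto
  then show "0 < Re (flat_metric n (torus_atlas n) p v v)"
    by (simp add: flat_metric_def Let_def complex_mult_cnj cmod_power2 flip: c_def)
next
  fix c i j assume c: "c \<in> torus_atlas n" and i: "i < n" and j: "j < n"
  then obtain a where a: "c = torus_chart n a" by (auto simp: torus_atlas_def)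
  show "smooth_on n (snd c ` fst c) (\<lambda>x. flat_metric n (torus_atlas n) (chart_inv c x)
      (coordinate_vector n (torus_atlas n) c i (chart_inv c x))
      (coordinate_vector n (torus_atlas n) c j (chart_inv c x)))"
    unfolding smooth_on_def
  proof (intro allI Ck_on_const)
    show "openin (top_of_set (cspace n)) (snd c ` fst c)"
      by (simp add: a snd_torus_chart_image openin_box_around)
    fix x assume "x \<in> snd c ` fst c"
    then have p: "chart_inv c x \<in> fst c" using chart_inv_image_torus_chart by (auto simp: a)
    then have "chart_inv c x \<in> torus n" using UN_torus_atlas [of n] c by blast
    then show "flat_metric n (torus_atlas n) (chart_inv c x)
      (coordinate_vector n (torus_atlas n) c i (chart_inv c x))
      (coordinate_vector n (torus_atlas n) c j (chart_inv c x)) = (if i = j then 1 else 0)"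
      using some_torus_chart [of "chart_inv c x" n] c i j p
      by (simp add: flat_metric_def Let_def coordinate_vector_def jacobian_torus
          if_distrib [of cnj] if_distrib [of "\<lambda>c. c * _"] cong: if_cong)
  qed
qed (simp_all add: flat_metric_def Let_def algebra_simps sum.distrib sum_distrib_left)

section \<open>Entire curves in the torus\<close>

text \<open>Locally a chart coordinate of the curve is the lift \<open>F\<close> minus a constant
  lattice vector, so it inherits differentiability.\<close>

lemma holomorphic_curve_torus_proj:
  assumes F: "\<And>i. F i holomorphic_on UNIV"
  shows "holomorphic_curve n (top_of_set (torus n)) (torus_atlas n) (\<lambda>z. torus_proj n (\<lambda>i. F i z))"
    (is "holomorphic_curve n _ _ ?f")
  unfolding holomorphic_curve_def
proof (intro conjI ballI allI impI)
  have cF: "continuous_on UNIV (F i)" for i using F by (rule holomorphic_on_imp_continuous_on)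
  have "continuous_on UNIV ?f"
    by (rule continuous_on_compose2 [OF continuous_on_torus_proj [of UNIV]])
      (auto intro: continuous_on_coordinatewise_then_product cF)
  then show "continuous_map euclidean (top_of_set (torus n)) ?f"
    by (auto simp: continuous_map_in_subtopology torus_proj_in_torus)
  fix c i assume "c \<in> torus_atlas n" and i: "i < n"
  then obtain a where c: "c = torus_chart n a" by (auto simp: torus_atlas_def)
  show "(\<lambda>z. snd c (?f z) i) holomorphic_on (?f -` fst c)"
    unfolding holomorphic_on_def
  proof
    fix z assume z: "z \<in> ?f -` fst c"
    define y where "y = snd c (?f z)"
    \<comment> \<open>\<open>G\<close> is the lift moved into the box of the chart: it takes the
      value \<open>y\<close> at \<open>z\<close>, and it equals the chart coordinates of the curve
      as long as it stays in the box.\<close>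
    define G where "G = (\<lambda>w i. if i < n then F i w - (F i z - y i) else 0)"
    have y: "y \<in> box_around n a" "torus_proj n y = ?f z"
      using z snd_torus_chart_in_box torus_proj_torus_chart by (auto simp: y_def c)
    obtain V where V: "open V" "box_around n a = cspace n \<inter> V"
      using openin_box_around [of n a] by (auto simp: openin_open)
    have "continuous_on UNIV (\<lambda>w. G w j)" for j
      unfolding G_def by (cases "j < n") (auto intro!: continuous_intros cF)
    then have "open (G -` V)"
      using V by (intro open_vimage continuous_on_coordinatewise_then_product)
    moreover have "G z = y"
      using y by (auto simp: G_def fun_eq_iff box_around_def cspace_def)
    then have "z \<in> G -` V" using y V by auto
    moreover have "G w i = snd c (?f w) i" if "w \<in> G -` V" for w
    proof -
      have "G w \<in> box_around n a" using that by (auto simp: V G_def cspace_def)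
      moreover have "torus_proj n (G w) = ?f w"
        unfolding torus_proj_eq_iff
      proof (intro allI impI)
        fix j assume j: "j < n"
        have "Re (G w j) - Re (F j w) = Re (y j) - Re (F j z)"
          "Im (G w j) - Im (F j w) = Im (y j) - Im (F j z)" using j by (simp_all add: G_def)
        then show "Re (G w j) - Re (F j w) \<in> \<int> \<and> Im (G w j) - Im (F j w) \<in> \<int>"
          using y(2) j by (simp add: torus_proj_eq_iff)
      qed
      ultimately show ?thesis unfolding c by (metis snd_torus_chart)
    qed
    moreover have "(\<lambda>w. G w i) field_differentiable at z"
      using F [of i] i unfolding G_def
      by (auto intro!: derivative_intros simp: holomorphic_on_def)
    ultimately have "(\<lambda>w. snd c (?f w) i) field_differentiable at z"
      by (meson field_differentiable_def has_field_derivative_transform_within_open)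
    then show "(\<lambda>w. snd c (?f w) i) field_differentiable at z within ?f -` fst c"
      by (rule field_differentiable_at_within)
  qed
qed

section \<open>The velocity of an entire curve and Liouville's theorem\<close>

definition velocity :: "nat \<Rightarrow> (complex \<Rightarrow> cvec) \<Rightarrow> complex \<Rightarrow> cvec"
  where "velocity n f z =
    (let c = (SOME c. c \<in> torus_atlas n \<and> f z \<in> fst c) in (\<lambda>i. deriv (\<lambda>w. snd c (f w) i) z))"

context
  fixes n :: nat and f :: "complex \<Rightarrow> cvec"
  assumes f: "holomorphic_curve n (top_of_set (torus n)) (torus_atlas n) f"
begin

lemma curve_in_torus: "f z \<in> torus n"
  using f by (auto simp: holomorphic_curve_def continuous_map_in_subtopology)

lemma open_curve_vimage_chart:
  assumes "c \<in> torus_atlas n"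
  shows "open (f -` fst c)"
proof -
  have "openin (top_of_set (torus n)) (fst c)"
    using assms is_chart_torus_chart unfolding torus_atlas_def is_chart_def by blast
  moreover have "continuous_map euclidean (top_of_set (torus n)) f"
    using f by (simp add: holomorphic_curve_def)
  ultimately have "openin euclidean {z \<in> topspace euclidean. f z \<in> fst c}"
    by (rule openin_continuous_map_preimage [rotated])
  then show ?thesis by (simp add: vimage_def)
qed

text \<open>Coordinates in two charts differ by a constant, so the derivative in the chart picked by
  \<open>velocity\<close> is the derivative in every chart. This makes \<open>velocity\<close> a
  global entire object.\<close>

lemma curve_has_derivative:
  assumes c: "c \<in> torus_atlas n" and "f z \<in> fst c" "i < n"
  shows "((\<lambda>w. snd c (f w) i) has_field_derivative velocity n f z i) (at z)"
proof -
  define d where "d = (SOME d. d \<in> torus_atlas n \<and> f z \<in> fst d)"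
  have d: "d \<in> torus_atlas n" "f z \<in> fst d"
    using some_torus_chart [OF curve_in_torus] by (auto simp: d_def)
  obtain a b where ab: "d = torus_chart n a" "c = torus_chart n b"
    using c d by (auto simp: torus_atlas_def)
  obtain m where m: "\<And>p i. p \<in> fst d \<Longrightarrow> p \<in> fst c \<Longrightarrow> snd c p i = snd d p i - m i"
    unfolding ab by (rule torus_chart_change) blast
  have "(\<lambda>w. snd d (f w) i) holomorphic_on (f -` fst d)"
    using f d assms by (simp add: holomorphic_curve_def)
  then have "((\<lambda>w. snd d (f w) i) has_field_derivative velocity n f z i) (at z)"
    using d open_curve_vimage_chart [OF d(1)]
    by (auto simp: velocity_def Let_def d_def [symmetric] intro: holomorphic_derivI)
  then have "((\<lambda>w. snd d (f w) i - m i) has_field_derivative velocity n f z i) (at z)"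
    by (auto intro!: derivative_eq_intros)
  then show ?thesis
    by (rule has_field_derivative_transform_within_open [of _ _ _ "f -` fst d \<inter> f -` fst c"])
      (use c d assms m in \<open>auto intro!: open_Int open_curve_vimage_chart\<close>)
qed

lemma velocity_holomorphic:
  assumes "i < n"
  shows "(\<lambda>z. velocity n f z i) holomorphic_on UNIV"
  unfolding holomorphic_on_def
proof
  fix z
  obtain c where c: "c \<in> torus_atlas n" "f z \<in> fst c"
    using some_torus_chart [OF curve_in_torus] by blast
  have "(\<lambda>w. snd c (f w) i) holomorphic_on (f -` fst c)"
    using f c assms by (simp add: holomorphic_curve_def)
  then have "deriv (\<lambda>w. snd c (f w) i) holomorphic_on (f -` fst c)"
    by (intro holomorphic_deriv open_curve_vimage_chart c)
  then have "(\<lambda>z. velocity n f z i) holomorphic_on (f -` fst c)"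
    by (rule holomorphic_transform) (use assms c in \<open>auto intro!: DERIV_imp_deriv curve_has_derivative\<close>)
  then show "(\<lambda>z. velocity n f z i) field_differentiable at z within UNIV"
    using c open_curve_vimage_chart [OF c(1)] by (auto simp: holomorphic_on_open field_differentiable_def)
qed

lemma differential_norm_torus:
  "differential_norm n (torus_atlas n) (flat_metric n (torus_atlas n)) f z = cnorm n (velocity n f z)"
proof -
  let ?N = "\<lambda>\<zeta>. metric_norm (flat_metric n (torus_atlas n)) (f z) (differential n (torus_atlas n) f z \<zeta>)"
  define c where "c = (SOME c. c \<in> torus_atlas n \<and> f z \<in> fst c)"
  have c: "c \<in> torus_atlas n" "f z \<in> fst c"
    using some_torus_chart [OF curve_in_torus] by (auto simp: c_def)
  have N: "?N \<zeta> = cnorm n (velocity n f z) * cmod \<zeta>" for \<zeta>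
  proof -
    have "?N \<zeta> = sqrt (\<Sum>i<n. (cmod (velocity n f z i * \<zeta>))\<^sup>2)"
      using c by (simp add: metric_norm_def flat_metric_def differential_def velocity_def Let_def
          complex_mult_cnj cmod_power2 flip: c_def)
    also have "\<dots> = sqrt ((\<Sum>i<n. (cmod (velocity n f z i))\<^sup>2) * (cmod \<zeta>)\<^sup>2)"
      by (simp add: norm_mult power_mult_distrib sum_distrib_right)
    finally show ?thesis by (simp add: cnorm_def real_sqrt_mult)
  qed
  have "cnorm n (velocity n f z) \<ge> 0" by (simp add: cnorm_def sum_nonneg)
  \<comment> \<open>For \<open>\<zeta> = 0\<close> the quotient is 0 by the convention on division,
    so nonnegativity of \<open>cnorm\<close> is what keeps the bound true there.\<close>
  then have le: "?N \<zeta> / cmod \<zeta> \<le> cnorm n (velocity n f z)" for \<zeta>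
    by (cases "\<zeta> = 0") (simp_all add: N)
  show ?thesis
    unfolding differential_norm_def
  proof (rule antisym)
    show "(SUP \<zeta>. ?N \<zeta> / cmod \<zeta>) \<le> cnorm n (velocity n f z)"
      by (rule cSUP_least) (use le in auto)
    have "?N 1 / cmod 1 \<le> (SUP \<zeta>. ?N \<zeta> / cmod \<zeta>)"
      by (rule cSUP_upper) (use le in \<open>auto intro!: bdd_aboveI2\<close>)
    then show "cnorm n (velocity n f z) \<le> (SUP \<zeta>. ?N \<zeta> / cmod \<zeta>)" by (simp add: N)
  qed
qed

lemma velocity_const:
  assumes "bounded_derivative n (torus_atlas n) (flat_metric n (torus_atlas n)) f"
  obtains d where "\<And>z i. i < n \<Longrightarrow> velocity n f z i = d i"
proof -
  obtain C where C: "\<And>z. cnorm n (velocity n f z) < C"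
    using assms by (auto simp: bounded_derivative_def differential_norm_torus)
  have "\<exists>e. \<forall>z. velocity n f z i = e" if "i < n" for i
  proof -
    have "cmod (velocity n f z i) \<le> C" for z
    proof -
      have "(cmod (velocity n f z i))\<^sup>2 \<le> (\<Sum>i<n. (cmod (velocity n f z i))\<^sup>2)"
        using that by (intro member_le_sum) auto
      then have "cmod (velocity n f z i) \<le> cnorm n (velocity n f z)"
        unfolding cnorm_def by (rule real_le_rsqrt)
      then show ?thesis using C [of z] by simp
    qed
    then have "bounded (range (\<lambda>z. velocity n f z i))" by (auto simp: bounded_iff)
    then show ?thesis
      using Liouville_theorem [OF velocity_holomorphic [OF that]] by (auto simp: constant_on_def)
  qed
  then have "\<forall>i. \<exists>e. i < n \<longrightarrow> (\<forall>z. velocity n f z i = e)" by blast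
  then obtain d where "\<forall>i. i < n \<longrightarrow> (\<forall>z. velocity n f z i = d i)" by metis
  then show ?thesis using that by blast
qed

end

section \<open>Curves of bounded derivative are affine lines\<close>

lemma torus_proj_add: "torus_proj n (\<lambda>i. x i + y i) j = torus_proj n x j * torus_proj n y j"
  by (simp add: torus_proj_def cis_mult distrib_left)

text \<open>Conjugation is inversion in the circle group; the indices from \<open>2 * n\<close> on
  are padding with value 0.\<close>

lemma torus_proj_mult_cnj: "torus_proj n x j * cnj (torus_proj n x j) = (if j < 2 * n then 1 else 0)"
  by (simp add: torus_proj_def cis_cnj cis_mult)

text \<open>The constant velocity supplies the direction \<open>d\<close>. Dividing \<open>f\<close>
  by the line with this direction in the group leaves a locally constant map on the connected plane,
  whose value supplies the base point \<open>b\<close>.\<close>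

lemma bounded_derivative_torus_affine:
  assumes f: "holomorphic_curve n (top_of_set (torus n)) (torus_atlas n) f"
    and bd: "bounded_derivative n (torus_atlas n) (flat_metric n (torus_atlas n)) f"
  obtains b d where "f = (\<lambda>z. torus_proj n (\<lambda>i. b i + d i * z))"
proof -
  obtain d where d: "\<And>z i. i < n \<Longrightarrow> velocity n f z i = d i"
    by (rule velocity_const [OF f bd]) blast
  \<comment> \<open>\<open>f(z) - d z\<close>, written multiplicatively in \<open>(S\<^sup>1)\<^sup>2\<^sup>n\<close>, is locally constant.\<close>
  define q where "q = (\<lambda>z j. f z j * cnj (torus_proj n (\<lambda>i. d i * z) j))"
  have local: "\<exists>b r. 0 < r \<and> (\<forall>w\<in>ball z r. q w = torus_proj n b)" for z
  proof -
    obtain c where c: "c \<in> torus_atlas n" "f z \<in> fst c"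
      using some_torus_chart [OF curve_in_torus [OF f]] by blast
    then obtain r where r: "0 < r" "ball z r \<subseteq> f -` fst c"
      using open_curve_vimage_chart [OF f c(1)] by (meson openE vimageI)
    have "\<exists>b. \<forall>w\<in>ball z r. snd c (f w) i - d i * w = b" if i: "i < n" for i
    proof -
      have "((\<lambda>w. snd c (f w) i - d i * w) has_field_derivative 0) (at w within ball z r)"
        if "w \<in> ball z r" for w
      proof -
        have "f w \<in> fst c" using that r by blast
        from curve_has_derivative [OF f c(1) this i]
        have "((\<lambda>w. snd c (f w) i - d i * w) has_field_derivative d i - d i * 1) (at w)"
          by (intro derivative_intros) (simp_all add: d [OF i])
        then show ?thesis by (simp add: has_field_derivative_at_within)
      qed
      then show ?thesis
        using has_field_derivative_zero_constant [OF convex_ball] by blast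
    qed
    then have "\<forall>i. \<exists>b. i < n \<longrightarrow> (\<forall>w\<in>ball z r. snd c (f w) i - d i * w = b)" by blast
    then obtain b where "\<forall>i. i < n \<longrightarrow> (\<forall>w\<in>ball z r. snd c (f w) i - d i * w = b i)" by metis
    then have b: "snd c (f w) i = b i + d i * w" if "i < n" "w \<in> ball z r" for i w
      using that by (metis diff_add_cancel)
    have "q w = torus_proj n b" if w: "w \<in> ball z r" for w
    proof -
      have "f w = torus_proj n (snd c (f w))"
        using c r w by (auto simp: torus_atlas_def torus_proj_torus_chart subset_iff)
      also have "\<dots> = torus_proj n (\<lambda>i. b i + d i * w)"
        using b w by (simp add: torus_proj_eq_iff)
      finally have "q w j = torus_proj n b j * (if j < 2 * n then 1 else 0)" for j
        by (simp only: q_def torus_proj_add mult.assoc torus_proj_mult_cnj)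
      then show ?thesis by (auto simp: fun_eq_iff torus_proj_def)
    qed
    then show ?thesis using r by blast
  qed
  have "q constant_on UNIV"
  proof (rule locally_constant_imp_constant)
    fix z
    obtain b r where "0 < r" "\<forall>w\<in>ball z r. q w = torus_proj n b" using local by blast
    then show "\<exists>T. openin (top_of_set UNIV) T \<and> z \<in> T \<and> (\<forall>x\<in>T. q x = q z)"
      by (intro exI [of _ "ball z r"]) auto
  qed auto
  moreover obtain b where "q 0 = torus_proj n b" using local [of 0] centre_in_ball by blast
  ultimately have q: "q z = torus_proj n b" for z by (metis UNIV_I constant_on_def)
  have "f z j = torus_proj n (\<lambda>i. b i + d i * z) j" for z j
  proof -
    have "f z j = 0" if "\<not> j < 2 * n"
      using curve_in_torus [OF f, of z] that by (auto simp: torus_def torus_proj_def)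
    then have "f z j * (torus_proj n (\<lambda>i. d i * z) j * cnj (torus_proj n (\<lambda>i. d i * z) j)) = f z j"
      by (simp only: torus_proj_mult_cnj) simp
    then have "f z j = q z j * torus_proj n (\<lambda>i. d i * z) j" by (simp add: q_def mult_ac)
    then show ?thesis by (simp only: q torus_proj_add)
  qed
  then have "f = (\<lambda>z. torus_proj n (\<lambda>i. b i + d i * z))" by blast
  then show ?thesis by (rule that)
qed

section \<open>The domain\<close>

definition torus_point :: "complex \<Rightarrow> complex \<Rightarrow> cvec"
  where "torus_point z w = torus_proj 2 (\<lambda>i. if i = 0 then z else w)"

lemma torus_point_coords [simp]:
  "torus_point z w 0 = cis (2 * pi * Re z)" "torus_point z w (Suc 0) = cis (2 * pi * Re w)"
  "torus_point z w 2 = cis (2 * pi * Im z)" "torus_point z w 3 = cis (2 * pi * Im w)"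
  by (simp_all add: torus_point_def torus_proj_def)

lemma torus_proj_2: "torus_proj 2 x = torus_point (x 0) (x 1)"
  unfolding torus_point_def torus_proj_eq_iff by (auto simp: less_2_cases_iff)

lemma torus_point_in_torus: "torus_point z w \<in> torus 2"
  by (simp add: torus_point_def torus_proj_in_torus)

lemma torus_2_cases:
  assumes "p \<in> torus 2"
  obtains z w where "p = torus_point z w"
  using assms by (auto simp: torus_def torus_proj_2)

lemma holomorphic_curve_torus_point:
  assumes "F holomorphic_on UNIV" "G holomorphic_on UNIV"
  shows "holomorphic_curve 2 (top_of_set (torus 2)) (torus_atlas 2) (\<lambda>t. torus_point (F t) (G t))"
proof -
  have "torus_point (F t) (G t) = torus_proj 2 (\<lambda>i. (if i = 0 then F else G) t)" for t
    by (simp add: torus_point_def if_distrib [of "\<lambda>h. h t"])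
  then show ?thesis
    using holomorphic_curve_torus_proj [of "\<lambda>i. if i = 0 then F else G" 2] assms by simp
qed

text \<open>This is the function \<open>g\<close> of the overview. It has period
  \<open>\<i>\<close>, and the factor 1/8 makes its values over the strips small compared with a
  quarter of a period of the lattice.\<close>

definition wave :: "complex \<Rightarrow> complex"
  where "wave z = exp (- exp (2 * of_real pi * z)) / 8"

section \<open>Estimates for \<open>wave\<close>\<close>

lemma wave_holomorphic: "wave holomorphic_on S"
  unfolding wave_def by (intro holomorphic_intros) auto

lemma cmod_wave: "cmod (wave z) = exp (- (exp (2 * pi * Re z) * cos (2 * pi * Im z))) / 8"
  by (simp add: wave_def norm_divide Re_exp)

lemma cmod_wave_le: "0 \<le> cos (2 * pi * Im z) \<Longrightarrow> cmod (wave z) \<le> 1/8"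
  by (simp add: cmod_wave)

lemma exp_pi_half_ge: "4 \<le> exp (pi / 2)"
proof -
  have "4 \<le> (1 + 3/2 / real 10) ^ 10" by (simp add: power_divide eval_nat_numeral)
  also have "\<dots> \<le> exp (3/2)" by (rule exp_ge_one_plus_x_over_n_power_n) auto
  also have "\<dots> \<le> exp (pi / 2)" using pi_gt3 by simp
  finally show ?thesis .
qed

text \<open>The inner exponential has modulus at least \<open>exp (pi / 2)\<close>, hence at least
  4, and real part at least 2. So \<open>wave\<close> is bounded by \<open>exp (- 2) / 8\<close>,
  which is at most 1/48.\<close>

lemma cmod_wave_right:
  assumes "1/2 \<le> cos (2 * pi * Im z)" "1/4 \<le> Re z"
  shows "cmod (wave z) \<le> 1/48"
proof -
  have "pi / 2 \<le> 2 * pi * Re z" using assms(2) pi_gt_zero by (simp add: field_simps)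
  then have "4 \<le> exp (2 * pi * Re z)" using exp_pi_half_ge by (meson exp_le_cancel_iff order_trans)
  then have "4 * (1/2) \<le> exp (2 * pi * Re z) * cos (2 * pi * Im z)"
    using assms by (intro mult_mono) auto
  then have "exp (- (exp (2 * pi * Re z) * cos (2 * pi * Im z))) \<le> exp (- 2)" by simp
  also have "\<dots> \<le> 1/6"
  proof -
    have "6 \<le> (1 + 2 / real 10) ^ 10" by (simp add: power_divide eval_nat_numeral)
    also have "\<dots> \<le> exp 2" by (rule exp_ge_one_plus_x_over_n_power_n) auto
    finally show ?thesis by (simp add: exp_minus field_simps)
  qed
  finally show ?thesis by (simp add: cmod_wave)
qed

text \<open>Here the inner exponential \<open>u\<close> has modulus at most 1/4, so
  \<open>exp (- u)\<close> is close to 1. Its real part is at least 3/4 times 19/20, which exceeds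
  7/10, and division by 8 gives 7/80.\<close>

lemma Re_wave_left:
  assumes "Re z \<le> -1/4"
  shows "7/80 \<le> Re (wave z)"
proof -
  define u where "u = exp (2 * of_real pi * z)"
  have "2 * pi * Re z \<le> - (pi / 2)" using mult_left_mono [OF assms, of "2 * pi"] by simp
  then have "cmod u \<le> exp (- (pi / 2))" by (simp add: u_def)
  also have "\<dots> \<le> 1/4" using exp_pi_half_ge by (simp add: exp_minus field_simps)
  finally have u: "cmod u \<le> 1/4" .
  then have Re: "Re u \<le> 1/4" and Im: "\<bar>Im u\<bar> \<le> 1/4"
    using complex_Re_le_cmod [of u] abs_Im_le_cmod [of u] by linarith+
  have "3/4 \<le> exp (- Re u)" using exp_ge_add_one_self [of "- Re u"] Re by linarith
  moreover have "19/20 \<le> cos (Im u)"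
  proof -
    have "\<bar>sin (Im u / 2)\<bar> \<le> \<bar>Im u / 2\<bar>" by (rule abs_sin_x_le_abs_x)
    then have "\<bar>sin (Im u / 2)\<bar> \<le> 1/8" using Im by simp
    then have "(sin (Im u / 2))\<^sup>2 \<le> (1/8)\<^sup>2" by (metis abs_ge_zero power2_abs power_mono)
    then show ?thesis using cos_double_sin [of "Im u / 2"] by (simp add: power2_eq_square)
  qed
  ultimately have "3/4 * (19/20) \<le> exp (- Re u) * cos (Im u)" by (intro mult_mono) auto
  moreover have "Re (wave z) = exp (- Re u) * cos (Im u) / 8"
    by (simp add: wave_def u_def [symmetric] Re_exp)
  ultimately show ?thesis by simp
qed

text \<open>The radius 1/1000 fits into the margins between 1/48 and 1/40 and between 3/40 and 7/80,
  which are the bounds that separate the two ranges of \<open>wave\<close> in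
  \<open>closure_Omega1_gap\<close>.\<close>

definition Omega1 :: "cvec set"
  where "Omega1 = {p \<in> torus 2. Re (p 2) < 0} \<union>
    {torus_point z (wave z + c) | z c. cmod c < 1/1000}"

text \<open>
  If \<open>p = (z, w)\<close> then \<open>p 2 = cis (2 \<pi> Im z)\<close> and \<open>p 1 = cis (2 \<pi> Re w)\<close>: the obstacle consists of the points
  with \<open>Re w\<close> between \<open>1/32\<close> and \<open>1/16\<close> (or their mirror images under \<open>Re w \<mapsto> 1/2 - Re w\<close>), a band containing
  \<open>g(0)\<close>.
\<close>

definition obstacle :: "cvec set"
  where "obstacle = {p \<in> torus 2. 1/2 \<le> Re (p 2) \<and> sin (pi/16) \<le> Im (p 1) \<and> Im (p 1) \<le> sin (pi/8)}"

text \<open>The tube is the image of an open subset of \<open>cspace 2\<close> under the open map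
  \<open>torus_proj 2\<close>.\<close>

lemma openin_Omega1: "openin (top_of_set (torus 2)) Omega1"
  unfolding Omega1_def
proof (rule openin_Un)
  have "open {p :: cvec. Re (p 2) < 0}" by (intro open_Collect_less continuous_intros)
  then have "openin (top_of_set (torus 2)) (torus 2 \<inter> {p. Re (p 2) < 0})" by (rule openin_open_Int)
  then show "openin (top_of_set (torus 2)) {p \<in> torus 2. Re (p 2) < 0}" by (simp add: Int_def)
  have "continuous_on UNIV (\<lambda>x :: cvec. wave (x 0))"
    by (rule continuous_on_compose2 [OF holomorphic_on_imp_continuous_on [OF wave_holomorphic [of UNIV]]])
      (auto intro: continuous_intros)
  then have "open {x :: cvec. cmod (x 1 - wave (x 0)) < 1/1000}"
    by (intro open_Collect_less continuous_intros)
  then have "openin (top_of_set (cspace 2)) (cspace 2 \<inter> {x. cmod (x 1 - wave (x 0)) < 1/1000})"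
    by (rule openin_open_Int)
  then have "openin (top_of_set (torus 2))
      (torus_proj 2 ` (cspace 2 \<inter> {x. cmod (x 1 - wave (x 0)) < 1/1000}))"
    using open_map_torus_proj unfolding open_map_def by blast
  also have "torus_proj 2 ` (cspace 2 \<inter> {x. cmod (x 1 - wave (x 0)) < 1/1000}) =
      {torus_point z (wave z + c) | z c. cmod c < 1/1000}" (is "?L = ?R")
  proof
    show "?L \<subseteq> ?R"
    proof
      fix p assume "p \<in> ?L"
      then obtain x where "x \<in> {x. cmod (x 1 - wave (x 0)) < 1/1000}" "p = torus_proj 2 x" by blast
      then have "cmod (x 1 - wave (x 0)) < 1/1000" "p = torus_point (x 0) (x 1)"
        by (simp_all only: torus_proj_2 mem_Collect_eq)
      then show "p \<in> ?R" by (intro CollectI exI [of _ "x 0"] exI [of _ "x 1 - wave (x 0)"]) simp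
    qed
    show "?R \<subseteq> ?L"
    proof
      fix p assume "p \<in> ?R"
      then obtain z c where *: "p = torus_point z (wave z + c)" "cmod c < 1/1000" by blast
      let ?x = "\<lambda>i :: nat. if i = 0 then z else if i = 1 then wave z + c else 0"
      have "p = torus_proj 2 ?x" using * by (simp add: torus_proj_2)
      moreover have "?x \<in> cspace 2" by (simp add: cspace_def)
      moreover have "cmod (?x 1 - wave (?x 0)) < 1/1000" using * by simp
      ultimately show "p \<in> ?L" by blast
    qed
  qed
  finally show "openin (top_of_set (torus 2)) {torus_point z (wave z + c) | z c. cmod c < 1/1000}" .
qed

lemma closedin_obstacle: "closedin (top_of_set (torus 2)) obstacle"
proof -
  have "closed {p :: cvec. 1/2 \<le> Re (p 2) \<and> sin (pi/16) \<le> Im (p 1) \<and> Im (p 1) \<le> sin (pi/8)}"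
    by (intro closed_Collect_conj closed_Collect_le continuous_intros)
  then have "closedin (top_of_set (torus 2))
      (torus 2 \<inter> {p. 1/2 \<le> Re (p 2) \<and> sin (pi/16) \<le> Im (p 1) \<and> Im (p 1) \<le> sin (pi/8)})"
    by (rule closedin_closed_Int)
  then show ?thesis by (simp add: obstacle_def Int_def)
qed

section \<open>Closed conditions on the closure of \<open>Omega1\<close>\<close>

lemma wave_tube_coords:
  assumes "cmod c < 1/1000" "0 < cos (2 * pi * Im z)"
  shows "\<bar>Re (wave z + c)\<bar> < 1/4" "\<bar>Im (wave z + c)\<bar> < 1/4"
proof -
  have "cmod (wave z + c) < 1/4"
    using norm_triangle_ineq [of "wave z" c] cmod_wave_le [of z] assms by linarith
  then show "\<bar>Re (wave z + c)\<bar> < 1/4" "\<bar>Im (wave z + c)\<bar> < 1/4"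
    using abs_Re_le_cmod abs_Im_le_cmod by (metis le_less_trans)+
qed

lemma cos_2pi_pos: "\<bar>x\<bar> < 1/4 \<Longrightarrow> 0 < cos (2 * pi * x)"
proof (rule cos_gt_zero_pi)
  assume "\<bar>x\<bar> < 1/4"
  then have "2 * pi * \<bar>x\<bar> < 2 * pi * (1/4)" by (intro mult_strict_left_mono) auto
  then have "\<bar>2 * pi * x\<bar> < pi/2" by (simp add: abs_mult)
  then show "- (pi/2) < 2 * pi * x" "2 * pi * x < pi/2" by linarith+
qed

text \<open>Over the strips the tube has \<open>w\<close> of modulus below 1/4, where both cosines
  are positive. Weak inequalities make the condition closed, so it passes to the closure.\<close>

lemma closure_Omega1_small:
  assumes "p \<in> (top_of_set (torus 2)) closure_of Omega1"
  shows "Re (p 2) \<le> 0 \<or> (0 \<le> Re (p 1) \<and> 0 \<le> Re (p 3))"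
proof -
  let ?C = "{p :: cvec. Re (p 2) \<le> 0 \<or> (0 \<le> Re (p 1) \<and> 0 \<le> Re (p 3))}"
  have "closed ?C"
    by (intro closed_Collect_disj closed_Collect_conj closed_Collect_le continuous_intros)
  then have "closedin (top_of_set (torus 2)) (torus 2 \<inter> ?C)" by (rule closedin_closed_Int)
  moreover have "Omega1 \<subseteq> torus 2 \<inter> ?C"
  proof
    fix p assume p: "p \<in> Omega1"
    then have "p \<in> torus 2" using openin_imp_subset [OF openin_Omega1] by blast
    moreover have "p \<in> ?C"
    proof (cases "Re (p 2) \<le> 0")
      case False
      then obtain z c where "p = torus_point z (wave z + c)" "cmod c < 1/1000"
        using p by (auto simp: Omega1_def)
      then show ?thesis
        using wave_tube_coords [of c z] False by (simp add: cos_2pi_pos less_imp_le)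
    qed simp
    ultimately show "p \<in> torus 2 \<inter> ?C" by blast
  qed
  ultimately have "(top_of_set (torus 2)) closure_of Omega1 \<subseteq> torus 2 \<inter> ?C"
    by (intro closure_of_minimal)
  then show ?thesis using assms by blast
qed

text \<open>If \<open>Re (p 0) < 0\<close>, every lift satisfies \<open>Re z \<ge> 1/4\<close> or
  \<open>Re z \<le> -1/4\<close>. In the first case \<open>wave z\<close> is near 0, in the second
  near 1/8. The angles \<open>pi/20\<close> and \<open>3*pi/20\<close> correspond to
  \<open>Re w = 1/40\<close> and \<open>Re w = 3/40\<close>.\<close>

lemma closure_Omega1_gap:
  assumes "p \<in> (top_of_set (torus 2)) closure_of Omega1"
  shows "0 \<le> Re (p 0) \<or> Re (p 2) \<le> 1/2 \<or> Im (p 1) \<le> sin (pi/20) \<or> sin (3*pi/20) \<le> Im (p 1)"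
proof -
  let ?C = "{p :: cvec. 0 \<le> Re (p 0) \<or> Re (p 2) \<le> 1/2 \<or> Im (p 1) \<le> sin (pi/20) \<or> sin (3*pi/20) \<le> Im (p 1)}"
  have "closed ?C"
    by (intro closed_Collect_disj closed_Collect_le continuous_intros)
  then have "closedin (top_of_set (torus 2)) (torus 2 \<inter> ?C)" by (rule closedin_closed_Int)
  moreover have "Omega1 \<subseteq> torus 2 \<inter> ?C"
  proof
    fix p assume p: "p \<in> Omega1"
    then have "p \<in> torus 2" using openin_imp_subset [OF openin_Omega1] by blast
    moreover have "p \<in> ?C"
    proof (cases "0 \<le> Re (p 0) \<or> Re (p 2) \<le> 1/2")
      case False
      then obtain z c where pz: "p = torus_point z (wave z + c)" and c: "cmod c < 1/1000"
        using p by (auto simp: Omega1_def)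
      have z: "cos (2 * pi * Re z) < 0" "1/2 < cos (2 * pi * Im z)" using False pz by auto
      have "\<bar>Re (wave z + c)\<bar> < 1/4" using wave_tube_coords [OF c] z by auto
      then have "2 * pi * \<bar>Re (wave z + c)\<bar> < 2 * pi * (1/4)" by (intro mult_strict_left_mono) auto
      then have small: "\<bar>2 * pi * Re (wave z + c)\<bar> < pi/2" by (simp add: abs_mult)
      have Rec: "\<bar>Re c\<bar> < 1/1000" using abs_Re_le_cmod [of c] c by linarith
      have "1/4 \<le> Re z \<or> Re z \<le> -1/4" using cos_2pi_pos [of "Re z"] z by linarith
      then have "sin (2 * pi * Re (wave z + c)) \<le> sin (pi/20) \<or>
          sin (3*pi/20) \<le> sin (2 * pi * Re (wave z + c))"
      proof
        assume "1/4 \<le> Re z"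
        then have "Re (wave z) \<le> 1/48"
          using cmod_wave_right [of z] z complex_Re_le_cmod [of "wave z"] by linarith
        then have "Re (wave z + c) \<le> 1/40" using Rec by simp
        then have "2 * pi * Re (wave z + c) \<le> 2 * pi * (1/40)" by (intro mult_left_mono) auto
        then have "sin (2 * pi * Re (wave z + c)) \<le> sin (pi/20)"
          using small by (intro sin_monotone_2pi_le) auto
        then show ?thesis ..
      next
        assume "Re z \<le> -1/4"
        then have "3/40 \<le> Re (wave z + c)" using Re_wave_left [of z] Rec by simp
        then have "2 * pi * (3/40) \<le> 2 * pi * Re (wave z + c)" by (intro mult_left_mono) auto
        then have "sin (3*pi/20) \<le> sin (2 * pi * Re (wave z + c))"
          using small pi_gt_zero by (intro sin_monotone_2pi_le) auto
        then show ?thesis ..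
      qed
      then show ?thesis by (auto simp: pz)
    qed auto
    ultimately show "p \<in> torus 2 \<inter> ?C" by blast
  qed
  ultimately have "(top_of_set (torus 2)) closure_of Omega1 \<subseteq> torus 2 \<inter> ?C"
    by (intro closure_of_minimal)
  then show ?thesis using assms by blast
qed

section \<open>Lines in the closure of \<open>Omega1\<close>\<close>

lemma cos_2pi_affine_neg:
  assumes "b \<noteq> (0::real)"
  shows "\<exists>t. cos (2 * pi * (a + b * t)) < 0"
proof
  have "2 * pi * (a + b * ((1/2 - a) / b)) = pi" using assms by simp
  then show "cos (2 * pi * (a + b * ((1/2 - a) / b))) < 0" by (metis cos_pi neg_less_0_iff_less zero_less_one)
qed

text \<open>A vertical line has to lie over the complement of the open strips, away from the
  obstacle. Any other line is a graph over the \<open>z\<close>-plane; smallness of \<open>w\<close>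
  makes it horizontal, and the gap condition then keeps its height out of the band of the
  obstacle.\<close>

lemma line_in_closure_Omega1_avoids_obstacle:
  assumes f: "f = (\<lambda>t. torus_point (x + a * t) (y + b * t))" and nc: "\<not> f constant_on UNIV"
    and sub: "range f \<subseteq> (top_of_set (torus 2)) closure_of Omega1"
  shows "f t \<notin> obstacle"
proof (cases "a = 0")
  case True
  have "b \<noteq> 0" using nc True by (auto simp: f constant_on_def)
  \<comment> \<open>At \<open>w = 1/2\<close> the coordinate \<open>p 1\<close> is -1, so
    \<open>closure_Omega1_small\<close> leaves only the alternative on \<open>p 2\<close>.\<close>
  then have "y + b * ((1/2 - y) / b) = 1/2" by simp
  then have "f ((1/2 - y) / b) = torus_point x (1/2)" by (simp only: f True) simp
  then have "torus_point x (1/2) \<in> (top_of_set (torus 2)) closure_of Omega1"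
    using sub by (metis range_subsetD)
  then have "cos (2 * pi * Im x) \<le> 0" using closure_Omega1_small by fastforce
  then show ?thesis by (simp add: f True obstacle_def)
next
  case False
  have eq: "f ((s - x) / a) = torus_point s (y - b * x / a + b / a * s)" for s
  proof -
    have "x + a * ((s - x) / a) = s" using False by simp
    moreover have "y + b * ((s - x) / a) = y - b * x / a + b / a * s"
      by (simp add: field_simps False)
    ultimately show ?thesis by (simp only: f)
  qed
  define e where "e = b / a"
  define y' where "y' = y - b * x / a"
  have cl: "torus_point s (y' + e * s) \<in> (top_of_set (torus 2)) closure_of Omega1" for s
    using sub eq [of s] unfolding y'_def e_def by (metis range_subsetD)
  \<comment> \<open>For real \<open>s\<close> the coordinate \<open>p 2\<close> is 1, so only the
    conditions on \<open>w\<close> remain. A nonzero real or imaginary part of the slope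
    \<open>e\<close> would make one of the cosines negative for some \<open>s\<close>.\<close>
  have real: "0 \<le> cos (2 * pi * (Re y' + Re e * s)) \<and> 0 \<le> cos (2 * pi * (Im y' + Im e * s))" for s
    using closure_Omega1_small [OF cl [of "of_real s"]] by simp
  have "e = 0"
    using real cos_2pi_affine_neg [of "Re e" "Re y'"] cos_2pi_affine_neg [of "Im e" "Im y'"]
    by (metis complex_eqI not_less zero_complex.simps)
  then have "b = 0" "y' = y" using False by (auto simp: e_def y'_def)
  \<comment> \<open>The point over \<open>z = 1/2\<close> has \<open>p 0 = -1\<close> and
    \<open>p 2 = 1\<close>, which excludes the first two alternatives of the gap condition.\<close>
  have "sin (2 * pi * Re y) \<le> sin (pi/20) \<or> sin (3*pi/20) \<le> sin (2 * pi * Re y)"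
    using closure_Omega1_gap [OF cl [of "1/2"]] by (auto simp: \<open>e = 0\<close> \<open>y' = y\<close>)
  moreover have "sin (pi/20) < sin (pi/16)" "sin (pi/8) < sin (3*pi/20)"
    using pi_gt_zero by (auto intro!: sin_monotone_2pi)
  ultimately show ?thesis by (auto simp: f \<open>b = 0\<close> obstacle_def)
qed

section \<open>Entire curves filling \<open>Omega1\<close>\<close>

lemma torus_point_not_constant_left: "\<not> (\<lambda>t. torus_point (z + t) (G t)) constant_on UNIV"
proof
  assume "(\<lambda>t. torus_point (z + t) (G t)) constant_on UNIV"
  then obtain q where "torus_point (z + t) (G t) = q" for t by (auto simp: constant_on_def)
  then have "torus_point (z + (- z)) (G (- z)) 0 = torus_point (z + (1/2 - z)) (G (1/2 - z)) 0"
    by (simp only:)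
  then show False by (simp add: complex_eq_iff)
qed

lemma torus_point_not_constant_right: "\<not> (\<lambda>t. torus_point z (w + t)) constant_on UNIV"
proof
  assume "(\<lambda>t. torus_point z (w + t)) constant_on UNIV"
  then obtain q where "torus_point z (w + t) = q" for t by (auto simp: constant_on_def)
  then have "torus_point z (w + (- w)) 1 = torus_point z (w + (1/2 - w)) 1"
    by (simp only:)
  then show False by (simp add: complex_eq_iff)
qed

text \<open>In the tube the offset \<open>c\<close> from the graph is kept fixed along the curve, so
  the translated graph never leaves the tube. Where \<open>Re (p 2) < 0\<close>, the first variable
  is fixed and the second is free.\<close>

lemma entire_curve_in_Omega1:
  assumes "p \<in> Omega1"
  shows "\<exists>f. holomorphic_curve 2 (top_of_set (torus 2)) (torus_atlas 2) f \<and> range f \<subseteq> Omega1 \<and>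
    \<not> f constant_on UNIV \<and> f 0 = p"
proof (cases "Re (p 2) < 0")
  case True
  have "p \<in> torus 2" using assms openin_imp_subset [OF openin_Omega1] by blast
  then obtain z w where p: "p = torus_point z w" by (rule torus_2_cases)
  show ?thesis
  proof (intro exI conjI)
    show "holomorphic_curve 2 (top_of_set (torus 2)) (torus_atlas 2) (\<lambda>t. torus_point z (w + t))"
      by (intro holomorphic_curve_torus_point holomorphic_intros)
    show "range (\<lambda>t. torus_point z (w + t)) \<subseteq> Omega1"
      using True by (auto simp: p Omega1_def torus_point_in_torus)
  qed (simp_all add: p torus_point_not_constant_right)
next
  case False
  then obtain z c where p: "p = torus_point z (wave z + c)" "cmod c < 1/1000"
    using assms by (auto simp: Omega1_def)
  show ?thesis
  proof (intro exI conjI)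
    show "holomorphic_curve 2 (top_of_set (torus 2)) (torus_atlas 2)
        (\<lambda>t. torus_point (z + t) (wave (z + t) + c))"
      unfolding wave_def by (intro holomorphic_curve_torus_point holomorphic_intros) auto
    show "range (\<lambda>t. torus_point (z + t) (wave (z + t) + c)) \<subseteq> Omega1"
      using p(2) by (auto simp: Omega1_def)
  qed (simp_all add: p torus_point_not_constant_left)
qed

text \<open>The open set \<open>?U\<close> meets the torus only inside the obstacle, so it misses
  the closure of the difference, yet it contains the point of the graph over 0.\<close>

lemma not_dense_in_Omega1:
  "(subtopology (top_of_set (torus 2)) Omega1) closure_of (Omega1 - obstacle) \<noteq> Omega1"
proof -
  let ?p = "torus_point 0 (wave 0)"
  let ?U = "{p :: cvec. 1/2 < Re (p 2) \<and> sin (pi/16) < Im (p 1) \<and> Im (p 1) < sin (pi/8)}"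
  have "open ?U" by (intro open_Collect_conj open_Collect_less continuous_intros)
  then have U: "openin (top_of_set (torus 2)) (torus 2 \<inter> ?U)" by (rule openin_open_Int)
  have w: "wave 0 = of_real (exp (- 1) / 8)"
    using exp_of_real [of "- 1", where 'a = complex] by (simp add: wave_def)
  \<comment> \<open>The angle at this point is \<open>pi / (4 * exp 1)\<close>; these bounds place
    it strictly between \<open>pi/16\<close> and \<open>pi/8\<close>.\<close>
  have "2 < exp (1::real)" "exp (1::real) < 4"
    using e_approx_32 by (simp_all add: abs_if split: if_split_asm)
  then have "pi/16 < 2 * pi * Re (wave 0)" "2 * pi * Re (wave 0) < pi/8"
    by (simp_all add: w exp_minus field_simps)
  then have "sin (pi/16) < sin (2 * pi * Re (wave 0))" "sin (2 * pi * Re (wave 0)) < sin (pi/8)"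
    using pi_gt_zero by (intro sin_monotone_2pi; linarith)+
  then have p: "?p \<in> torus 2 \<inter> ?U" by (simp add: torus_point_in_torus w)
  have "(torus 2 \<inter> ?U) \<inter> (top_of_set (torus 2)) closure_of (Omega1 - obstacle) = {}"
    unfolding openin_Int_closure_of_eq_empty [OF U] by (auto simp: obstacle_def)
  with p have "?p \<notin> (top_of_set (torus 2)) closure_of (Omega1 - obstacle)" by blast
  then have "?p \<notin> (subtopology (top_of_set (torus 2)) Omega1) closure_of (Omega1 - obstacle)"
    by (meson closure_of_subtopology_subset subsetD)
  moreover have "?p \<in> Omega1"
    unfolding Omega1_def by (intro UnI2 CollectI exI [of _ 0]) simp
  ultimately show ?thesis by blast
qed

theorem theorem1:
  shows "\<exists>(n :: nat) (T :: (nat \<Rightarrow> complex) topology) (A :: (nat \<Rightarrow> complex) chart set)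
            (h :: (nat \<Rightarrow> complex) metric_tensor) \<Omega>\<^sub>1 \<Omega>\<^sub>2.
    compact_complex_manifold n T A \<and> hermitian_metric n T A h \<and>
    openin T \<Omega>\<^sub>1 \<and> openin T \<Omega>\<^sub>2 \<and> \<Omega>\<^sub>2 \<subseteq> \<Omega>\<^sub>1 \<and>
    (subtopology T \<Omega>\<^sub>1) closure_of \<Omega>\<^sub>2 \<noteq> \<Omega>\<^sub>1 \<and> T closure_of \<Omega>\<^sub>1 \<noteq> topspace T \<and>
    (\<forall>p\<in>\<Omega>\<^sub>1. \<exists>f. holomorphic_curve n T A f \<and> range f \<subseteq> \<Omega>\<^sub>1 \<and>
                 \<not> f constant_on UNIV \<and> f 0 = p) \<and>
    (\<forall>f. holomorphic_curve n T A f \<and> \<not> f constant_on UNIV \<and>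
         bounded_derivative n A h f \<and> range f \<subseteq> T closure_of \<Omega>\<^sub>1 \<longrightarrow>
         range f \<subseteq> T closure_of \<Omega>\<^sub>2)"
proof ((rule exI)+, intro conjI ballI allI impI)
  let ?T = "top_of_set (torus 2)"
  show "compact_complex_manifold 2 ?T (torus_atlas 2)" by (rule compact_complex_manifold_torus)
  show "hermitian_metric 2 ?T (torus_atlas 2) (flat_metric 2 (torus_atlas 2))"
    by (rule hermitian_metric_torus)
  show "openin ?T Omega1" by (rule openin_Omega1)
  show "openin ?T (Omega1 - obstacle)" by (rule openin_diff [OF openin_Omega1 closedin_obstacle])
  show "Omega1 - obstacle \<subseteq> Omega1" by blast
  show "(subtopology ?T Omega1) closure_of (Omega1 - obstacle) \<noteq> Omega1"
    by (rule not_dense_in_Omega1)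
  \<comment> \<open>Here \<open>p 2 = 1\<close> and \<open>p 1 = -1\<close>, so both alternatives of
    \<open>closure_Omega1_small\<close> fail.\<close>
  have "torus_point 0 (1/2) \<notin> ?T closure_of Omega1"
    using closure_Omega1_small [of "torus_point 0 (1/2)"] by auto
  then show "?T closure_of Omega1 \<noteq> topspace ?T" using torus_point_in_torus by auto
  show "\<exists>f. holomorphic_curve 2 ?T (torus_atlas 2) f \<and> range f \<subseteq> Omega1 \<and>
      \<not> f constant_on UNIV \<and> f 0 = p" if "p \<in> Omega1" for p
    using that by (rule entire_curve_in_Omega1)
  fix f assume f: "holomorphic_curve 2 ?T (torus_atlas 2) f \<and> \<not> f constant_on UNIV \<and>
    bounded_derivative 2 (torus_atlas 2) (flat_metric 2 (torus_atlas 2)) f \<and>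
    range f \<subseteq> ?T closure_of Omega1"
  then obtain b d where "f = (\<lambda>z. torus_proj 2 (\<lambda>i. b i + d i * z))"
    using bounded_derivative_torus_affine by blast
  then have "f = (\<lambda>z. torus_point (b 0 + d 0 * z) (b 1 + d 1 * z))" by (simp add: torus_proj_2)
  then have avoid: "f t \<notin> obstacle" for t
    using line_in_closure_Omega1_avoids_obstacle f by blast
  show "range f \<subseteq> ?T closure_of (Omega1 - obstacle)"
  proof (intro image_subsetI)
    fix t
    have "f t \<in> ?T closure_of Omega1" using f by blast
    \<comment> \<open>The obstacle is closed, so \<open>f t\<close> is not a limit of points of
      \<open>Omega1 \<inter> obstacle\<close>. The closure of a union being the union of the
      closures, it is a limit of points of the difference.\<close>
    then have "f t \<in> ?T closure_of Omega1 - ?T closure_of obstacle"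
      using avoid closedin_obstacle by (simp add: closure_of_closedin)
    then show "f t \<in> ?T closure_of (Omega1 - obstacle)"
      using closure_of_Un [of ?T "Omega1 - obstacle" "Omega1 \<inter> obstacle"]
        closure_of_mono [of "Omega1 \<inter> obstacle" obstacle ?T] by (auto simp: Un_Diff_Int)
  qed
qed

end
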